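(* Let $j\in\{1,\dots,N\}$ and let $\Omega\subset\mathbb R^N$ be a (nonempty) bounded, open and convex set. Then $\Omega\in\mathcal G_j$ if and only if $\Omega\in\mathcal C_{N-j+1}$.
   Context: $\mathcal G_j$ condition: a bounded convex domain $\Omega\subset\mathbb R^N$ belongs to $\mathcal G_j$ if for any $y\in\partial\Omega$ and any $r>0$ there exists $\delta>0$ such that for every $x\in B_\delta(y)\cap\Omega$ and every linear subspace $S\subset\mathbb R^N$ with $\dim S=j$ there exists a unit vector $v\in S$ such that $\{x+tv\}_{t\in\mathbb R}\cap B_r(y)\cap\partial\Omega\ne\emptyset$. Here $B_r(y)$ is the open ball of radius $r$ centered at $y$. A domain (nonempty open connected set) $\omega\subset\mathbb R^i$ is strictly convex if $(1-t)x+ty\in\omega$ for all $x\ne y$ in $\overline\omega$ and $0<t<1$. For $i\in\{1,\dots,N\}$ let $C_i$ be the collection of sets $C=\omega\times\mathbb R^{N-i}\subset\mathbb R^N$ with $\omega\subset\mathbb R^i$ a bounded strictly convex domain (located anywhere in $\mathbb R^i$). $\mathcal C_i$ is the class of bounded convex domains $\Omega\subset\mathbb R^N$ such that for each $x\in\partial\Omega$ there exist an orthogonal $N\times N$ matrix $O$ and $C\in C_i$ with $\Omega\subset OC$ and $x\in\partial(OC)$. *)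

theory Defs
  imports "HOL-Analysis.Analysis"
begin

definition domain :: "'a::topological_space set \<Rightarrow> bool" where
  "domain D \<longleftrightarrow> D \<noteq> {} \<and> open D \<and> connected D"

definition bounded_convex_domain :: "'a::real_normed_vector set \<Rightarrow> bool" where
  "bounded_convex_domain D \<longleftrightarrow> domain D \<and> bounded D \<and> convex D"

definition class_G :: "nat \<Rightarrow> (real^'n) set set" where
  "class_G j = {\<Omega>. bounded_convex_domain \<Omega> \<and>
     (\<forall>y\<in>frontier \<Omega>. \<forall>r>0. \<exists>\<delta>>0. \<forall>x\<in>ball y \<delta> \<inter> \<Omega>. \<forall>S. subspace S \<and> dim S = j \<longrightarrow>
        (\<exists>v\<in>S. norm v = 1 \<and> range (\<lambda>t::real. x + t *\<^sub>R v) \<inter> ball y r \<inter> frontier \<Omega> \<noteq> {}))}"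

text \<open>
  The index type of \<^typ>\<open>real^'n\<close> carries no order, so "the first \<open>i\<close> coordinates" refers to the
  enumeration of \<^typ>\<open>'n\<close> by \<open>0, \<dots>, CARD('n) - 1\<close> that \<^const>\<open>to_nat_on\<close> provides.
  The space of \<open>i\<close>-tuples is identified with the subspace of \<^typ>\<open>real^'n\<close> on which all other
  coordinates vanish. It is closed, so \<^const>\<open>closure\<close>, \<^const>\<open>connected\<close> and \<^const>\<open>bounded\<close>
  have the same meaning in the subspace as in \<^typ>\<open>real^'n\<close>; only openness has to be relativised.
\<close>

definition first_coords :: "nat \<Rightarrow> 'n::finite set" where
  "first_coords i = {k. to_nat_on (UNIV :: 'n set) k < i}"

lemma card_first_coords:
  assumes "i \<le> CARD('n)"
  shows "card (first_coords i :: 'n::finite set) = i"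
proof -
  have bij: "bij_betw (to_nat_on (UNIV :: 'n set)) UNIV {..<CARD('n)}"
    by (simp add: to_nat_on_finite)
  have "to_nat_on (UNIV :: 'n set) ` first_coords i = {..<i}"
  proof
    show "{..<i} \<subseteq> to_nat_on (UNIV :: 'n set) ` first_coords i"
    proof
      fix m assume m: "m \<in> {..<i}"
      then have "m \<in> to_nat_on (UNIV :: 'n set) ` UNIV"
        using bij assms by (auto simp: bij_betw_def)
      then show "m \<in> to_nat_on (UNIV :: 'n set) ` first_coords i"
        using m by (auto simp: first_coords_def)
    qed
  qed (auto simp: first_coords_def)
  moreover have "inj_on (to_nat_on (UNIV :: 'n set)) (first_coords i)"
    using bij by (auto simp: bij_betw_def intro: inj_on_subset)
  ultimately show ?thesis
    by (metis card_image card_lessThan)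
qed

definition coord_space :: "nat \<Rightarrow> (real^'n) set" where
  "coord_space i = {x. \<forall>k. k \<notin> first_coords i \<longrightarrow> x $ k = 0}"

definition coord_proj :: "nat \<Rightarrow> real^'n \<Rightarrow> real^'n" where
  "coord_proj i x = (\<chi> k. if k \<in> first_coords i then x $ k else 0)"

definition strictly_convex_domain_in ::
  "'a::real_normed_vector set \<Rightarrow> 'a set \<Rightarrow> bool" where
  "strictly_convex_domain_in V \<omega> \<longleftrightarrow>
     \<omega> \<noteq> {} \<and> openin (top_of_set V) \<omega> \<and> connected \<omega> \<and>
     (\<forall>x\<in>closure \<omega>. \<forall>y\<in>closure \<omega>. \<forall>t::real.
        x \<noteq> y \<and> 0 < t \<and> t < 1 \<longrightarrow> (1 - t) *\<^sub>R x + t *\<^sub>R y \<in> \<omega>)"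

text \<open>
  Under the identification above, the product of \<open>\<omega>\<close> with the space of the remaining coordinates
  is the preimage of \<open>\<omega>\<close> under \<open>coord_proj i\<close>.
\<close>

definition cylinders :: "nat \<Rightarrow> (real^'n) set set" where
  "cylinders i = {coord_proj i -` \<omega> |\<omega>.
     bounded \<omega> \<and> strictly_convex_domain_in (coord_space i) \<omega>}"

definition class_C :: "nat \<Rightarrow> (real^'n) set set" where
  "class_C i = {\<Omega>. bounded_convex_domain \<Omega> \<and>
     (\<forall>x\<in>frontier \<Omega>. \<exists>A :: real^'n^'n. \<exists>C\<in>cylinders i.
        orthogonal_matrix A \<and> \<Omega> \<subseteq> (*v) A ` C \<and> x \<in> frontier ((*v) A ` C))}"

end

(*
  Both classes consist of the sets whose boundary contains no j-dimensional disc.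

  G: along the directions of such a disc, centred at y, the boundary stays far from points of the
  set close to y. Conversely, if the condition fails at y, a limit of the offending subspaces
  (taken in the compact set of orthogonal matrices) gives a disc centred at y.

  C: a cylinder has only j - 1 flat directions, so a disc through y projects to a proper segment
  around the projection of y, which strict convexity of the base forbids. Conversely, intersecting
  the closure with a supporting hyperplane at y gives a face of dimension less than j. Projecting
  along a (j-1)-dimensional space that contains the directions of this face and lies in the
  hyperplane turns y into an exposed point of a compact set K, with exposing functional e. The base
  is {x. Theta(|x - z|^2) < e(x - z)} within a large ball around the projection z of y, where
  Theta is convex and strictly increasing with Theta(|k - z|^2) <= e(k - z)/2 on K.
*)
theory Submission
  imports Defs
begin

section \<open>Coordinate subspaces and orthogonal matrices\<close>

lemma subspace_coord_space: "subspace (coord_space i)"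
  by (auto simp: subspace_def coord_space_def)

lemma dim_coord_space:
  assumes "i \<le> CARD('n)"
  shows "dim (coord_space i :: (real^'n) set) = i"
  unfolding coord_space_def dim_vec_eq[symmetric] dim_substandard_cart
  by (rule card_first_coords[OF assms])

lemma coord_proj_in_coord_space: "coord_proj i x \<in> coord_space i"
  by (simp add: coord_space_def coord_proj_def)

lemma linear_coord_proj: "linear (coord_proj i)"
  by (rule linearI) (auto simp: coord_proj_def vec_eq_iff)

lemma coord_proj_id: "x \<in> coord_space i \<Longrightarrow> coord_proj i x = x"
  by (auto simp: coord_space_def coord_proj_def vec_eq_iff)

lemma inner_coord_proj: "c \<in> coord_space i \<Longrightarrow> c \<bullet> coord_proj i x = c \<bullet> x"
  unfolding inner_vec_def by (intro sum.cong) (auto simp: coord_space_def coord_proj_def)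

text \<open>Subspaces of equal dimension are isometric, and so are their orthogonal complements. The
  two isometries glue to an isometry of the whole space.\<close>

lemma orthogonal_matrix_onto_subspace:
  fixes T :: "(real^'n) set"
  assumes T: "subspace T" "dim T = i" and i: "i \<le> CARD('n)"
  obtains A :: "real^'n^'n" where "orthogonal_matrix A" "(*v) A ` coord_space i = T"
proof -
  let ?S = "coord_space i :: (real^'n) set"
  let ?S' = "{y \<in> UNIV. \<forall>x\<in>?S. orthogonal x y}" and ?T' = "{y \<in> UNIV. \<forall>x\<in>T. orthogonal x y}"
  have "dim ?S' + dim ?S = dim (UNIV :: (real^'n) set)"
    by (rule dim_subspace_orthogonal_to_vectors) (auto simp: subspace_coord_space)
  moreover have "dim ?T' + dim T = dim (UNIV :: (real^'n) set)"
    by (rule dim_subspace_orthogonal_to_vectors) (auto simp: T)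
  ultimately have d': "dim ?S' = dim ?T'" and d: "dim ?S = dim T"
    using dim_coord_space[OF i] T by auto
  obtain f where f: "linear f" "f ` ?S = T" "\<And>x. x \<in> ?S \<Longrightarrow> norm (f x) = norm x"
    by (rule isometry_subspaces[OF subspace_coord_space T(1) d]) blast
  have "subspace ?S'" "subspace ?T'"
    by (auto simp: subspace_def orthogonal_def inner_add_right)
  then obtain g where g: "linear g" "g ` ?S' = ?T'" "\<And>x. x \<in> ?S' \<Longrightarrow> norm (g x) = norm x"
    by (rule isometry_subspaces[OF _ _ d']) blast
  \<comment> \<open>The orthogonal sum of \<open>f\<close> and \<open>g\<close>; Pythagoras in the
    domain and in the image shows that it preserves norms.\<close>
  define F where "F x = f (coord_proj i x) + g (x - coord_proj i x)" for x
  have perp: "x - coord_proj i x \<in> ?S'" for x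
    by (auto simp: orthogonal_def inner_diff_right inner_coord_proj)
  have "linear F"
    unfolding F_def
    by (intro linear_compose_add linear_compose[OF linear_coord_proj f(1), unfolded o_def]
        linear_compose[OF _ g(1), unfolded o_def] linear_compose_sub linear_ident linear_coord_proj)
  moreover have "norm (F x) = norm x" for x
  proof -
    let ?p = "coord_proj i x" and ?q = "x - coord_proj i x"
    have "f ?p \<in> T" "g ?q \<in> ?T'"
      using f(2) g(2) perp coord_proj_in_coord_space by blast+
    then have "(norm (F x))\<^sup>2 = (norm (f ?p))\<^sup>2 + (norm (g ?q))\<^sup>2"
      unfolding F_def by (intro norm_add_Pythagorean) auto
    also have "\<dots> = (norm ?p)\<^sup>2 + (norm ?q)\<^sup>2"
      unfolding f(3)[OF coord_proj_in_coord_space] g(3)[OF perp] ..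
    also have "\<dots> = (norm (?p + ?q))\<^sup>2"
      using perp coord_proj_in_coord_space by (intro norm_add_Pythagorean[symmetric]) blast
    finally show ?thesis by simp
  qed
  ultimately have "orthogonal_transformation F"
    by (simp add: orthogonal_transformation)
  then have "orthogonal_matrix (matrix F)"
    using orthogonal_transformation_matrix by blast
  moreover have "(*v) (matrix F) ` ?S = T"
  proof -
    have "F x = f x" if "x \<in> ?S" for x
      using that linear_0[OF g(1)] by (simp add: F_def coord_proj_id)
    then show ?thesis
      using f(2) \<open>linear F\<close> by (simp add: matrix_works)
  qed
  ultimately show ?thesis by (rule that)
qed

section \<open>Strictly convex domains touching a compact set at an exposed point\<close>

text \<open>Off \<open>u = 0\<close> the compact set \<open>K\<close> stays above the axis
  \<open>w = 0\<close>, so for each \<open>u > 0\<close> some line of positive slope vanishing at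
  \<open>u / 2\<close> lies below \<open>K\<close>. The supremum of such lines is convex and
  positive at every \<open>u > 0\<close>; with \<open>\<Theta> 0 = 0\<close>, convexity makes it
  strictly increasing on the nonnegative reals.\<close>

lemma convex_minorant_exists:
  fixes K :: "(real \<times> real) set"
  assumes K: "compact K" and nn: "\<And>u w. (u, w) \<in> K \<Longrightarrow> 0 \<le> u \<and> 0 \<le> w"
    and pos: "\<And>u. (u, 0) \<in> K \<Longrightarrow> u = 0"
  obtains \<Theta> :: "real \<Rightarrow> real" where "convex_on UNIV \<Theta>" "\<Theta> 0 = 0"
    "\<And>u v. 0 \<le> u \<Longrightarrow> u < v \<Longrightarrow> \<Theta> u < \<Theta> v" "\<And>u w. (u, w) \<in> K \<Longrightarrow> \<Theta> u \<le> w"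
proof -
  \<comment> \<open>The affine minorants of \<open>K\<close> with slope in \<open>[0, 1]\<close>; the slope bound keeps their supremum finite.\<close>
  define A where "A = {(a, s). 0 \<le> a \<and> a \<le> (1::real) \<and> 0 \<le> s \<and> (\<forall>(u, w)\<in>K. a * (u - s) \<le> w)}"
  define \<Theta> where "\<Theta> u = (SUP p\<in>A. fst p * (u - snd p))" for u
  have A0: "(0, 0) \<in> A"
    using nn by (auto simp: A_def)
  have "fst p * (u - snd p) \<le> \<bar>u\<bar>" if "p \<in> A" for p u
  proof -
    have "fst p * (u - snd p) \<le> fst p * \<bar>u\<bar>"
      using that by (intro mult_left_mono) (auto simp: A_def)
    also have "\<dots> \<le> 1 * \<bar>u\<bar>"
      using that by (intro mult_right_mono) (auto simp: A_def)
    finally show ?thesis by simp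
  qed
  then have bdd: "bdd_above ((\<lambda>p. fst p * (u - snd p)) ` A)" for u
    by (intro bdd_aboveI2)
  have upper: "a * (u - s) \<le> \<Theta> u" if "(a, s) \<in> A" for a s u
    unfolding \<Theta>_def using cSUP_upper[OF that bdd[of u]] by simp
  have least: "\<Theta> u \<le> M" if "\<And>a s. (a, s) \<in> A \<Longrightarrow> a * (u - s) \<le> M" for u M
    unfolding \<Theta>_def using A0 that by (intro cSUP_least) auto
  have conv: "convex_on UNIV \<Theta>"
  proof (rule convex_onI)
    fix t x y :: real
    assume t: "0 < t" "t < 1"
    show "\<Theta> ((1 - t) *\<^sub>R x + t *\<^sub>R y) \<le> (1 - t) * \<Theta> x + t * \<Theta> y"
    proof (rule least)
      fix a s
      assume as: "(a, s) \<in> A"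
      have "a * ((1 - t) *\<^sub>R x + t *\<^sub>R y - s) = (1 - t) * (a * (x - s)) + t * (a * (y - s))"
        by (simp add: algebra_simps)
      also have "\<dots> \<le> (1 - t) * \<Theta> x + t * \<Theta> y"
        using t upper[OF as] by (intro add_mono mult_left_mono) auto
      finally show "a * ((1 - t) *\<^sub>R x + t *\<^sub>R y - s) \<le> (1 - t) * \<Theta> x + t * \<Theta> y" .
    qed
  qed auto
  have zero: "\<Theta> 0 = 0"
  proof (rule antisym)
    show "\<Theta> 0 \<le> 0"
      by (rule least) (auto simp: A_def)
    show "0 \<le> \<Theta> 0"
      using upper[OF A0, of 0] by simp
  qed
  have gt: "0 < \<Theta> u" if u: "0 < u" for u
  proof -
    let ?K = "K \<inter> {p. u / 2 \<le> fst p}"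
    \<comment> \<open>\<open>c\<close> is the minimum of \<open>w / x\<close> over the compact part
      of \<open>K\<close> with \<open>u / 2 \<le> x\<close>, positive because \<open>K\<close> meets
      the axis \<open>w = 0\<close> at most in the origin. If that part is empty, any positive value
      serves.\<close>
    obtain c where c: "0 < c" "\<And>x w. (x, w) \<in> ?K \<Longrightarrow> c * x \<le> w"
    proof (cases "?K = {}")
      case True
      then show ?thesis by (intro that[of 1]) auto
    next
      case False
      have "compact ?K"
        by (intro compact_Int_closed K closed_Collect_le continuous_intros)
      moreover have "continuous_on ?K (\<lambda>p. snd p / fst p)"
        using u by (intro continuous_intros) auto
      ultimately obtain p where p: "p \<in> ?K" "\<And>q. q \<in> ?K \<Longrightarrow> snd p / fst p \<le> snd q / fst q"
        using continuous_attains_inf[OF _ False] by blast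
      obtain x w where xw: "p = (x, w)" by (cases p)
      show ?thesis
      proof (rule that)
        have "x > 0" "w \<ge> 0" "w \<noteq> 0"
          using p(1) u nn[of x w] pos[of x] by (auto simp: xw)
        then show "0 < snd p / fst p" by (simp add: xw)
        show "snd p / fst p * x' \<le> w'" if "(x', w') \<in> ?K" for x' w'
          using p(2)[OF that] that u by (simp add: pos_le_divide_eq)
      qed
    qed
    have "(min 1 c, u / 2) \<in> A"
      unfolding A_def
    proof (clarsimp, intro conjI ballI)
      show "0 \<le> c" "0 \<le> u" using c u by auto
    next
      fix q assume q: "q \<in> K"
      obtain x w where xw: "q = (x, w)" by (cases q)
      have "min 1 c * (x - u / 2) \<le> w"
      proof (cases "u / 2 \<le> x")
        case True
        have "min 1 c * (x - u / 2) \<le> c * x"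
          using True u c by (intro mult_mono) auto
        then show ?thesis using c(2)[of x w] True q xw by auto
      next
        case False
        then have "min 1 c * (x - u / 2) \<le> 0"
          using c by (intro mult_nonneg_nonpos) auto
        then show ?thesis using nn[of x w] q xw by auto
      qed
      then show "case q of (x, w) \<Rightarrow> min 1 c * (x - u / 2) \<le> w" by (simp add: xw)
    qed
    from upper[OF this, of u] show ?thesis
      using c u by (smt (verit) field_sum_of_halves mult_pos_pos)
  qed
  show ?thesis
  proof (rule that[OF conv zero])
    show "\<Theta> u < \<Theta> v" if "0 \<le> u" "u < v" for u v
    proof -
      \<comment> \<open>Here \<open>u\<close> is written as a convex combination of \<open>0\<close>
        and \<open>v\<close>.\<close>
      have "\<Theta> ((1 - u / v) *\<^sub>R 0 + (u / v) *\<^sub>R v) \<le> (1 - u / v) * \<Theta> 0 + (u / v) * \<Theta> v"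
        using that by (intro convex_onD[OF conv]) auto
      then have "\<Theta> u \<le> (u / v) * \<Theta> v"
        using that zero by simp
      also have "\<dots> < 1 * \<Theta> v"
        using that gt[of v] by (intro mult_strict_right_mono) auto
      finally show ?thesis by simp
    qed
    show "\<Theta> u \<le> w" if "(u, w) \<in> K" for u w
      using that by (intro least) (auto simp: A_def)
  qed
qed

lemma norm_convex_combination:
  fixes x y :: "'a::real_inner"
  shows "(norm ((1 - t) *\<^sub>R x + t *\<^sub>R y))\<^sup>2
    = (1 - t) * (norm x)\<^sup>2 + t * (norm y)\<^sup>2 - t * (1 - t) * (norm (x - y))\<^sup>2"
  unfolding power2_norm_eq_inner
  by (simp add: inner_simps inner_commute algebra_simps)

text \<open>The squared norm is strictly convex and \<open>\<Theta>\<close> is convex and strictly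
  increasing, so their composition is strictly convex; hence so is the region where it lies below
  the linear function \<open>e \<bullet> (x - z)\<close>. Cutting with a large ball makes the region
  bounded.\<close>

lemma strictly_convex_domain_at_exposed_point:
  fixes V :: "'a::euclidean_space set"
  assumes V: "subspace V" "K \<subseteq> V" "z \<in> V" and K: "compact K" "K - {z} \<noteq> {}"
    and e: "\<And>k. k \<in> K \<Longrightarrow> k \<noteq> z \<Longrightarrow> 0 < e \<bullet> (k - z)"
  obtains \<omega> where "bounded \<omega>" "strictly_convex_domain_in V \<omega>" "K - {z} \<subseteq> \<omega>" "z \<notin> \<omega>"
proof -
  \<comment> \<open>Halving the functional leaves room for a strict inequality, which puts
    \<open>K - {z}\<close> into the open region \<open>U\<close> and not just into
    \<open>C\<close>.\<close>
  let ?p = "\<lambda>k. ((norm (k - z))\<^sup>2, e \<bullet> (k - z) / 2)"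
  have e0: "0 \<le> e \<bullet> (k - z)" if "k \<in> K" for k
    using e[OF that] by (cases "k = z") auto
  have "compact (?p ` K)"
    by (intro compact_continuous_image continuous_intros K) simp
  then obtain \<Theta> where \<Theta>: "convex_on UNIV \<Theta>" "\<Theta> 0 = 0" "\<And>u v. 0 \<le> u \<Longrightarrow> u < v \<Longrightarrow> \<Theta> u < \<Theta> v"
    "\<And>u w. (u, w) \<in> ?p ` K \<Longrightarrow> \<Theta> u \<le> w"
  proof (rule convex_minorant_exists)
    show "0 \<le> u \<and> 0 \<le> w" if "(u, w) \<in> ?p ` K" for u w
      using that e0 by auto
    show "u = 0" if "(u, 0) \<in> ?p ` K" for u
      using that e by fastforce
  qed blast
  have cont: "continuous_on UNIV \<Theta>"
    by (intro convex_on_continuous \<Theta>(1)) simp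
  have cont': "continuous_on S (\<lambda>x. \<Theta> ((norm (x - z))\<^sup>2))" for S
    by (intro continuous_on_compose2[OF cont] continuous_intros) auto
  obtain R where R: "K \<subseteq> ball z R"
    using compact_imp_bounded[OF K(1)] bounded_subset_ballD by blast
  \<comment> \<open>\<open>V \<inter> U\<close> will be the domain. Its closure is controlled only
    through the closed set \<open>C\<close>, so \<open>strict\<close> is proved for endpoints in
    \<open>V \<inter> C\<close>; this yields both convexity and strict convexity.\<close>
  define U where "U = {x. norm (x - z) < R} \<inter> {x. \<Theta> ((norm (x - z))\<^sup>2) < e \<bullet> (x - z)}"
  define C where "C = {x. norm (x - z) \<le> R} \<inter> {x. \<Theta> ((norm (x - z))\<^sup>2) \<le> e \<bullet> (x - z)}"
  have "open U"
    unfolding U_def by (intro open_Int open_Collect_less continuous_intros cont')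
  moreover have "closed C"
    unfolding C_def by (intro closed_Int closed_Collect_le continuous_intros cont')
  ultimately have "closure (V \<inter> U) \<subseteq> V \<inter> C"
    using closed_subspace[OF V(1)] by (intro closure_minimal closed_Int) (auto simp: U_def C_def)
  have strict: "(1 - t) *\<^sub>R x + t *\<^sub>R y \<in> V \<inter> U"
    if xy: "x \<in> V \<inter> C" "y \<in> V \<inter> C" and t: "x \<noteq> y" "0 < t" "t < 1" for x y t
  proof -
    let ?m = "(1 - t) *\<^sub>R x + t *\<^sub>R y"
    have m: "?m - z = (1 - t) *\<^sub>R (x - z) + t *\<^sub>R (y - z)"
      by (simp add: algebra_simps)
    have "0 < t * (1 - t) * (norm (x - y))\<^sup>2"
      using t by simp
    then have lt: "(norm (?m - z))\<^sup>2 < (1 - t) * (norm (x - z))\<^sup>2 + t * (norm (y - z))\<^sup>2"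
      unfolding m norm_convex_combination by simp
    have "(1 - t) * (norm (x - z))\<^sup>2 + t * (norm (y - z))\<^sup>2 \<le> (1 - t) * R\<^sup>2 + t * R\<^sup>2"
      using xy t by (intro add_mono mult_left_mono power_mono) (auto simp: C_def)
    with lt have "(norm (?m - z))\<^sup>2 < R\<^sup>2"
      by (simp add: algebra_simps)
    moreover have "0 \<le> R"
      using xy norm_ge_zero[of "x - z"] by (simp add: C_def del: norm_ge_zero)
    ultimately have "norm (?m - z) < R"
      by (rule power2_less_imp_less)
    have "\<Theta> ((norm (?m - z))\<^sup>2) < \<Theta> ((1 - t) * (norm (x - z))\<^sup>2 + t * (norm (y - z))\<^sup>2)"
      by (intro \<Theta>(3) lt) simp
    also have "\<dots> \<le> (1 - t) * \<Theta> ((norm (x - z))\<^sup>2) + t * \<Theta> ((norm (y - z))\<^sup>2)"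
      using convex_onD[OF \<Theta>(1), of t] t by simp
    also have "\<dots> \<le> (1 - t) * (e \<bullet> (x - z)) + t * (e \<bullet> (y - z))"
      using xy t by (intro add_mono mult_left_mono) (auto simp: C_def)
    also have "\<dots> = e \<bullet> (?m - z)"
      unfolding m by (simp add: inner_add_right)
    finally have "\<Theta> ((norm (?m - z))\<^sup>2) < e \<bullet> (?m - z)" .
    moreover have "?m \<in> V"
      using xy V(1) by (simp add: subspace_add subspace_scale)
    ultimately show ?thesis
      using \<open>norm (?m - z) < R\<close> by (simp add: U_def)
  qed
  have sub: "K - {z} \<subseteq> V \<inter> U"
  proof
    fix k assume k: "k \<in> K - {z}"
    have "\<Theta> ((norm (k - z))\<^sup>2) \<le> e \<bullet> (k - z) / 2"
      using k by (intro \<Theta>(4)) auto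
    moreover have "0 < e \<bullet> (k - z)" "norm (k - z) < R"
      using k e R by (auto simp: dist_norm norm_minus_commute)
    ultimately show "k \<in> V \<inter> U"
      using k V by (auto simp: U_def)
  qed
  have "V \<inter> U \<subseteq> V \<inter> C"
    by (auto simp: U_def C_def)
  then have "convex (V \<inter> U)"
    unfolding convex_contains_open_segment
    using strict by (fastforce simp: in_segment)
  then have "strictly_convex_domain_in V (V \<inter> U)"
    unfolding strictly_convex_domain_in_def
    using \<open>closure (V \<inter> U) \<subseteq> V \<inter> C\<close> strict sub K(2) \<open>open U\<close>
    by (intro conjI convex_connected openin_open_Int) blast+
  moreover have "U \<subseteq> ball z R"
    by (auto simp: U_def dist_norm norm_minus_commute)
  then have "bounded (V \<inter> U)"
    by (meson bounded_ball bounded_subset inf_le2 order_trans)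
  \<comment> \<open>At \<open>z\<close> both sides of the inequality defining \<open>U\<close>
    vanish.\<close>
  moreover have "z \<notin> V \<inter> U"
    by (simp add: U_def \<Theta>(2))
  ultimately show ?thesis
    using sub that by blast
qed


section \<open>Flat discs in the boundary and the class G\<close>

text \<open>For convex \<open>\<Omega>\<close> the disc lies in the boundary although only the
  closure is mentioned: were \<open>y + s\<close> interior, then \<open>y\<close>, the midpoint of
  \<open>y + s\<close> and \<open>y - s\<close>, would be interior too.\<close>

definition boundary_flat :: "nat \<Rightarrow> 'a::euclidean_space set \<Rightarrow> bool" where
  "boundary_flat j \<Omega> \<longleftrightarrow> (\<exists>y\<in>frontier \<Omega>. \<exists>S \<rho>. subspace S \<and> dim S = j \<and> 0 < \<rho> \<and>
     (\<forall>s\<in>S. norm s < \<rho> \<longrightarrow> y + s \<in> closure \<Omega>))"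

text \<open>A slight contraction towards a point \<open>p\<close> of \<open>\<Omega>\<close> moves a
  boundary disc centred at \<open>y\<close> into \<open>\<Omega>\<close>. Its new centre
  \<open>x\<close> is close to \<open>y\<close>, yet lines through \<open>x\<close> in the
  directions of \<open>S\<close> meet the boundary only outside the contracted disc.\<close>

lemma class_G_imp_no_boundary_flat:
  assumes "\<Omega> \<in> class_G j"
  shows "\<not> boundary_flat j \<Omega>"
proof
  assume "boundary_flat j \<Omega>"
  then obtain y S \<rho> where y: "y \<in> frontier \<Omega>" and S: "subspace S" "dim S = j" and \<rho>: "0 < \<rho>"
    and flat: "\<And>s. s \<in> S \<Longrightarrow> norm s < \<rho> \<Longrightarrow> y + s \<in> closure \<Omega>"
    by (auto simp: boundary_flat_def)
  have \<Omega>: "\<Omega> \<noteq> {}" "open \<Omega>" "convex \<Omega>"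
    using assms by (auto simp: class_G_def bounded_convex_domain_def domain_def)
  have "\<forall>r>0. \<exists>\<delta>>0. \<forall>x\<in>ball y \<delta> \<inter> \<Omega>. \<forall>S. subspace S \<and> dim S = j \<longrightarrow>
      (\<exists>v\<in>S. norm v = 1 \<and> range (\<lambda>t. x + t *\<^sub>R v) \<inter> ball y r \<inter> frontier \<Omega> \<noteq> {})"
    using assms y by (auto simp: class_G_def)
  from this[rule_format, of "\<rho> / 2"] \<rho> obtain \<delta> where "0 < \<delta>"
    and \<delta>: "\<And>x. x \<in> ball y \<delta> \<inter> \<Omega> \<Longrightarrow>
      \<exists>v\<in>S. norm v = 1 \<and> range (\<lambda>t. x + t *\<^sub>R v) \<inter> ball y (\<rho> / 2) \<inter> frontier \<Omega> \<noteq> {}"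
    using S by (metis half_gt_zero)
  obtain p where p: "p \<in> \<Omega>" using \<Omega> by blast
  \<comment> \<open>With this \<open>D\<close>, the bound \<open>\<epsilon> * D < \<rho> / 2\<close>
    says that the contracted radius \<open>(1 - \<epsilon>) * \<rho>\<close> exceeds
    \<open>\<rho> / 2\<close> plus the distance from \<open>x\<close> to \<open>y\<close>;
    \<open>\<epsilon> * D < \<delta>\<close> keeps \<open>x\<close> in
    \<open>ball y \<delta>\<close>.\<close>
  define D where "D = norm (p - y) + \<rho>"
  have D: "0 < D" "\<rho> \<le> D" using \<rho> by (auto simp: D_def add_nonneg_pos)
  define \<epsilon> where "\<epsilon> = min (\<rho> / 2) \<delta> / (2 * D)"
  have eD: "\<epsilon> * D < \<rho> / 2" "\<epsilon> * D < \<delta>" and e0: "0 < \<epsilon>"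
    using D \<rho> \<open>0 < \<delta>\<close> by (auto simp: \<epsilon>_def min_def field_simps)
  have "\<epsilon> * \<rho> \<le> \<epsilon> * D" using D e0 by simp
  with eD have "\<epsilon> * \<rho> < 1 * \<rho>" using \<rho> by linarith
  then have e1: "\<epsilon> < 1" using \<rho> mult_less_cancel_right_pos by blast
  have shrink: "(1 - \<epsilon>) *\<^sub>R b + \<epsilon> *\<^sub>R p \<in> \<Omega>" if "b \<in> closure \<Omega>" for b
  proof -
    have "b - \<epsilon> *\<^sub>R (b - p) \<in> interior \<Omega>"
      using e0 e1 p \<Omega> that by (intro mem_interior_closure_convex_shrink) (auto simp: interior_open)
    then show ?thesis
      using \<Omega> by (simp add: interior_open algebra_simps)
  qed
  define x where "x = (1 - \<epsilon>) *\<^sub>R y + \<epsilon> *\<^sub>R p"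
  have "x \<in> \<Omega>" unfolding x_def using y by (intro shrink) (simp add: frontier_def)
  have "x - y = \<epsilon> *\<^sub>R (p - y)" by (simp add: x_def algebra_simps)
  then have xy: "norm (x - y) = \<epsilon> * norm (p - y)" using e0 by simp
  have "\<epsilon> * norm (p - y) \<le> \<epsilon> * D"
    using e0 \<rho> by (simp add: D_def)
  then have "x \<in> ball y \<delta>" using eD xy by (simp add: dist_norm norm_minus_commute)
  with \<delta> \<open>x \<in> \<Omega>\<close> obtain v t where v: "v \<in> S" "norm v = 1"
    and hit: "x + t *\<^sub>R v \<in> ball y (\<rho> / 2)" "x + t *\<^sub>R v \<in> frontier \<Omega>"
    by blast
  have "\<bar>t\<bar> = norm ((x + t *\<^sub>R v - y) - (x - y))" using v by simp
  also have "\<dots> \<le> norm (x + t *\<^sub>R v - y) + norm (x - y)" by (rule norm_triangle_ineq4)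
  also have "\<dots> < \<rho> / 2 + \<epsilon> * norm (p - y)"
    using hit(1) xy by (simp add: dist_norm norm_minus_commute)
  also have "\<dots> \<le> (1 - \<epsilon>) * \<rho>"
    using eD by (simp add: D_def algebra_simps)
  finally have "\<bar>t\<bar> / (1 - \<epsilon>) < \<rho>" using e1 by (simp add: field_simps)
  \<comment> \<open>This point of the original disc is the one that the contraction maps to
    \<open>x + t *\<^sub>R v\<close>.\<close>
  then have "y + (t / (1 - \<epsilon>)) *\<^sub>R v \<in> closure \<Omega>"
    using v S(1) e1 by (intro flat) (auto simp: subspace_scale)
  from shrink[OF this] have "x + t *\<^sub>R v \<in> \<Omega>"
    using e1 by (simp add: x_def scaleR_add_right add.assoc add.commute add.left_commute)
  then show False using hit(2) \<Omega> by (simp add: frontier_def interior_open)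
qed

section \<open>Limits of orthogonal matrices, and the converse for the class G\<close>

lemma tendsto_matrix_vector_mult_left:
  fixes A :: "real^'n^'m"
  assumes "(f \<longlongrightarrow> A) F"
  shows "((\<lambda>k. f k *v x) \<longlongrightarrow> A *v x) F"
  unfolding matrix_vector_mult_def
  by (intro vec_tendstoI) (auto intro!: tendsto_intros assms)

lemma dim_image_norm_preserving:
  fixes f :: "'a::euclidean_space \<Rightarrow> 'b::euclidean_space"
  assumes f: "linear f" and norm: "\<And>x. norm (f x) = norm x"
  shows "dim (f ` S) = dim S"
proof (rule dim_image_eq[OF f])
  have "inj f"
    unfolding linear_injective_0[OF f] using norm by (metis norm_eq_zero)
  then show "inj_on f (span S)"
    by (rule inj_on_subset) simp
qed

lemma orthogonal_matrix_norm:
  fixes A :: "real^'n^'n"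
  assumes "orthogonal_matrix A"
  shows "norm (A *v x) = norm x"
proof -
  have "orthogonal_transformation ((*v) A)"
    using assms by (simp add: orthogonal_transformation_matrix)
  then show ?thesis by (simp add: orthogonal_transformation)
qed

text \<open>The rows are unit vectors. Boundedness provides the convergent subsequence of matrices
  that stands in for a limit of subspaces.\<close>

lemma bounded_orthogonal_matrices: "bounded {A :: real^'n^'n. orthogonal_matrix A}"
proof (rule boundedI)
  fix A :: "real^'n^'n" assume "A \<in> {A. orthogonal_matrix A}"
  then have "norm (A $ i) = 1" for i
    by (auto simp: orthogonal_matrix_orthonormal_rows row_def)
  then show "norm A \<le> CARD('n)"
    using L2_set_le_sum[of UNIV "\<lambda>i. norm (A $ i)"] by (simp add: norm_vec_def)
qed

text \<open>A failure at \<open>y\<close> gives points \<open>x k\<close> tending to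
  \<open>y\<close> with discs of fixed radius \<open>r / 2\<close> around them inside
  \<open>\<Omega>\<close>. Parametrising all discs by the same \<open>coord_space j\<close> lets
  them converge pointwise to a disc in the closure centred at \<open>y\<close>.\<close>

lemma no_boundary_flat_imp_class_G:
  fixes \<Omega> :: "(real^'n) set"
  assumes \<Omega>: "bounded_convex_domain \<Omega>" and j: "j \<le> CARD('n)" and no_flat: "\<not> boundary_flat j \<Omega>"
  shows "\<Omega> \<in> class_G j"
  unfolding class_G_def
proof (intro CollectI conjI \<Omega> ballI allI impI, rule ccontr)
  fix y and r :: real
  assume y: "y \<in> frontier \<Omega>" and r: "0 < r"
  define hit where "hit x v \<longleftrightarrow> range (\<lambda>t. x + t *\<^sub>R v) \<inter> ball y r \<inter> frontier \<Omega> \<noteq> {}" for x v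
  assume "\<not> (\<exists>\<delta>>0. \<forall>x\<in>ball y \<delta> \<inter> \<Omega>. \<forall>S. subspace S \<and> dim S = j \<longrightarrow>
      (\<exists>v\<in>S. norm v = 1 \<and> range (\<lambda>t. x + t *\<^sub>R v) \<inter> ball y r \<inter> frontier \<Omega> \<noteq> {}))"
  then have bad: "\<exists>x\<in>ball y \<delta> \<inter> \<Omega>. \<exists>S. subspace S \<and> dim S = j \<and> (\<forall>v\<in>S. norm v = 1 \<longrightarrow> \<not> hit x v)"
    if "0 < \<delta>" for \<delta>
    unfolding hit_def[symmetric] using that by meson
  define \<delta> where "\<delta> k = r / 2 * inverse (real (Suc k))" for k
  have \<delta>: "0 < \<delta> k" "\<delta> k \<le> r / 2" for k
    using r by (auto simp: \<delta>_def field_simps)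
  have "\<exists>x A. x \<in> ball y (\<delta> k) \<inter> \<Omega> \<and> orthogonal_matrix A \<and>
     (\<forall>c\<in>coord_space j. norm c < r / 2 \<longrightarrow> x + A *v c \<in> \<Omega>)" for k
  proof -
    obtain x S where x: "x \<in> ball y (\<delta> k)" "x \<in> \<Omega>" and S: "subspace S" "dim S = j"
      and miss: "\<And>v. v \<in> S \<Longrightarrow> norm v = 1 \<Longrightarrow> \<not> hit x v"
      using bad[OF \<delta>(1)] by blast
    obtain A :: "real^'n^'n" where A: "orthogonal_matrix A" "(*v) A ` coord_space j = S"
      by (rule orthogonal_matrix_onto_subspace[OF S j])
    \<comment> \<open>Otherwise the segment from \<open>x\<close> would cross the boundary at
      distance less than \<open>\<delta> k + r / 2 \<le> r\<close> from \<open>y\<close>, in a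
      direction of \<open>S\<close>.\<close>
    have "x + A *v c \<in> \<Omega>" if c: "c \<in> coord_space j" "norm c < r / 2" for c
    proof (rule ccontr)
      assume "x + A *v c \<notin> \<Omega>"
      then have "closed_segment x (x + A *v c) \<inter> frontier \<Omega> \<noteq> {}"
        using x(2) by (intro connected_Int_frontier connected_segment) auto
      then obtain u where u: "0 \<le> u" "u \<le> 1" and fr: "x + u *\<^sub>R (A *v c) \<in> frontier \<Omega>"
        by (auto simp: in_segment algebra_simps)
      define v where "v = (1 / norm c) *\<^sub>R (A *v c)"
      have "c \<noteq> 0" using \<open>x + A *v c \<notin> \<Omega>\<close> x(2) by auto
      then have "norm v = 1" "x + u *\<^sub>R (A *v c) = x + (u * norm c) *\<^sub>R v"
        by (simp_all add: v_def orthogonal_matrix_norm[OF A(1)])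
      moreover have "v \<in> S"
        using A(2) c S(1) by (auto simp: v_def intro: subspace_scale)
      moreover have "x + u *\<^sub>R (A *v c) \<in> ball y r"
      proof -
        have "norm (x + u *\<^sub>R (A *v c) - y) \<le> norm (x - y) + norm (u *\<^sub>R (A *v c))"
          using norm_triangle_ineq[of "x - y" "u *\<^sub>R (A *v c)"] by (simp add: algebra_simps)
        also have "norm (u *\<^sub>R (A *v c)) \<le> norm c"
          using u by (simp add: orthogonal_matrix_norm[OF A(1)] mult_left_le_one_le)
        finally show ?thesis
          using x(1) c(2) \<delta>(2)[of k] by (simp add: dist_norm norm_minus_commute)
      qed
      ultimately show False using miss[of v] fr unfolding hit_def by (metis IntI emptyE rangeI)
    qed
    then show ?thesis using x A by blast
  qed
  then obtain x A where x: "\<And>k. x k \<in> ball y (\<delta> k)" and A: "\<And>k. orthogonal_matrix (A k)"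
    and xA: "\<And>k c. c \<in> coord_space j \<Longrightarrow> norm c < r / 2 \<Longrightarrow> x k + A k *v c \<in> \<Omega>"
    by (metis IntD1)
  have "bounded (range A)"
    by (rule bounded_subset[OF bounded_orthogonal_matrices]) (use A in auto)
  then obtain B q where q: "strict_mono q" and lim: "(A \<circ> q) \<longlonglongrightarrow> B"
    using bounded_imp_convergent_subsequence by blast
  have AB: "(\<lambda>k. A (q k) *v c) \<longlonglongrightarrow> B *v c" for c
    using tendsto_matrix_vector_mult_left[OF lim] by (simp add: o_def)
  \<comment> \<open>The limit matrix still preserves norms, so the limit subspace keeps dimension
    \<open>j\<close> and the limit disc keeps its radius.\<close>
  have "(\<lambda>k. norm (A (q k) *v c)) \<longlonglongrightarrow> norm (B *v c)" for c
    by (intro tendsto_norm AB)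
  then have normB: "norm (B *v c) = norm c" for c
    unfolding orthogonal_matrix_norm[OF A] by (metis LIMSEQ_unique tendsto_const)
  have "\<delta> \<longlonglongrightarrow> r / 2 * 0"
    unfolding \<delta>_def by (intro tendsto_intros LIMSEQ_inverse_real_of_nat)
  then have "\<delta> \<longlonglongrightarrow> 0" by simp
  then have "x \<longlonglongrightarrow> y"
  proof (rule metric_tendsto_imp_tendsto, intro always_eventually allI)
    show "dist (x k) y \<le> dist (\<delta> k) 0" for k
      using x[of k] \<delta>(1)[of k] by (simp add: dist_commute)
  qed
  then have "(x \<circ> q) \<longlonglongrightarrow> y"
    by (rule LIMSEQ_subseq_LIMSEQ[OF _ q])
  then have xq: "(\<lambda>k. x (q k)) \<longlonglongrightarrow> y" by (simp add: o_def)
  have "boundary_flat j \<Omega>"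
    unfolding boundary_flat_def
  proof (intro bexI[OF _ y] exI[of _ "(*v) B ` coord_space j"] exI[of _ "r / 2"] conjI ballI impI)
    show "subspace ((*v) B ` coord_space j)"
      by (intro linear_subspace_image matrix_vector_mul_linear subspace_coord_space)
    show "dim ((*v) B ` coord_space j) = j"
      by (simp add: dim_image_norm_preserving[OF matrix_vector_mul_linear normB] dim_coord_space[OF j])
    show "0 < r / 2" using r by simp
    fix s assume s: "s \<in> (*v) B ` coord_space j" "norm s < r / 2"
    then obtain c where c: "c \<in> coord_space j" "s = B *v c" by blast
    then have "norm c < r / 2" using s(2) normB by simp
    moreover have "(\<lambda>k. x (q k) + A (q k) *v c) \<longlonglongrightarrow> y + s"
      unfolding c(2) by (intro tendsto_add xq AB)
    ultimately show "y + s \<in> closure \<Omega>"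
      unfolding closure_sequential using xA[OF c(1)]
      by (intro exI[of _ "\<lambda>k. x (q k) + A (q k) *v c"]) simp
  qed
  with no_flat show False ..
qed

section \<open>Rotated cylinders and the class C\<close>

text \<open>The inverse of \<open>A\<close> is its transpose, so a rotated cylinder is the preimage
  of its base under a single linear map, called \<open>Q\<close> below.\<close>

lemma orthogonal_cylinder:
  fixes A :: "real^'n^'n"
  assumes A: "orthogonal_matrix A"
  shows "linear (\<lambda>x. coord_proj i (transpose A *v x))"
    and "(*v) A ` (coord_proj i -` \<omega>) = (\<lambda>x. coord_proj i (transpose A *v x)) -` \<omega>"
proof -
  show "linear (\<lambda>x. coord_proj i (transpose A *v x))"
    using linear_compose[OF matrix_vector_mul_linear[of "transpose A"] linear_coord_proj[of i]]
    by (simp only: o_def)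
  have inv: "transpose A *v (A *v x) = x" "A *v (transpose A *v x) = x" for x
    using A by (simp_all add: matrix_vector_mul_assoc orthogonal_matrix_def
        del: transpose_matrix_vector)
  show "(*v) A ` (coord_proj i -` \<omega>) = (\<lambda>x. coord_proj i (transpose A *v x)) -` \<omega>"
  proof (intro equalityI subsetI)
    fix x assume "x \<in> (*v) A ` (coord_proj i -` \<omega>)"
    then obtain c where "x = A *v c" "coord_proj i c \<in> \<omega>" by blast
    then show "x \<in> (\<lambda>x. coord_proj i (transpose A *v x)) -` \<omega>"
      by (simp only: vimage_eq inv)
  next
    fix x assume "x \<in> (\<lambda>x. coord_proj i (transpose A *v x)) -` \<omega>"
    then have "A *v (transpose A *v x) \<in> (*v) A ` (coord_proj i -` \<omega>)"
      by (intro imageI) (simp only: vimage_eq)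
    then show "x \<in> (*v) A ` (coord_proj i -` \<omega>)"
      by (simp only: inv)
  qed
qed

text \<open>The base is only relatively open, but the projection takes all its values in
  \<open>coord_space i\<close>, so \<open>\<omega>\<close> may be replaced by an open set of the
  whole space.\<close>

lemma open_orthogonal_cylinder:
  fixes A :: "real^'n^'n"
  assumes \<omega>: "strictly_convex_domain_in (coord_space i) \<omega>" and A: "orthogonal_matrix A"
  shows "open ((\<lambda>x. coord_proj i (transpose A *v x)) -` \<omega>)"
proof -
  obtain G where G: "open G" "\<omega> = coord_space i \<inter> G"
    using \<omega> by (auto simp: strictly_convex_domain_in_def openin_open)
  have "(\<lambda>x. coord_proj i (transpose A *v x)) -` \<omega> = (\<lambda>x. coord_proj i (transpose A *v x)) -` G"
    using coord_proj_in_coord_space by (auto simp: G(2))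
  moreover have "continuous_on UNIV (\<lambda>x. coord_proj i (transpose A *v x))"
    using orthogonal_cylinder(1)[OF A] by (simp add: linear_continuous_on linear_conv_bounded_linear)
  ultimately show ?thesis
    using G(1) by (simp add: open_vimage)
qed

text \<open>The kernel of \<open>Q\<close> has dimension \<open>CARD('n) - i < j\<close>, so some
  direction of the disc survives the projection and \<open>Q y\<close> becomes the midpoint of a
  proper segment in the closure of the base.\<close>

lemma class_C_imp_no_boundary_flat:
  fixes \<Omega> :: "(real^'n) set"
  assumes \<Omega>: "\<Omega> \<in> class_C i" and i: "i \<le> CARD('n)" "CARD('n) < i + j"
  shows "\<not> boundary_flat j \<Omega>"
proof
  assume "boundary_flat j \<Omega>"
  then obtain y S \<rho> where y: "y \<in> frontier \<Omega>" and S: "subspace S" "dim S = j" and \<rho>: "0 < \<rho>"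
    and flat: "\<And>s. s \<in> S \<Longrightarrow> norm s < \<rho> \<Longrightarrow> y + s \<in> closure \<Omega>"
    by (auto simp: boundary_flat_def)
  obtain A :: "real^'n^'n" and \<omega> where A: "orthogonal_matrix A"
    and \<omega>: "strictly_convex_domain_in (coord_space i) \<omega>"
    and sub: "\<Omega> \<subseteq> (*v) A ` (coord_proj i -` \<omega>)"
    and yC: "y \<in> frontier ((*v) A ` (coord_proj i -` \<omega>))"
    using \<Omega> y unfolding class_C_def cylinders_def by blast
  define Q where "Q x = coord_proj i (transpose A *v x)" for x

  have Q: "linear Q" and QC: "(*v) A ` (coord_proj i -` \<omega>) = Q -` \<omega>"
    using orthogonal_cylinder[OF A] by (simp_all add: Q_def[abs_def])
  have openC: "open (Q -` \<omega>)"
    unfolding Q_def[abs_def] using \<omega> A by (rule open_orthogonal_cylinder)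
  have closQ: "Q x \<in> closure \<omega>" if "x \<in> closure \<Omega>" for x
  proof -
    have "Q ` closure \<Omega> \<subseteq> closure (Q ` \<Omega>)"
      using linear_continuous_on[of Q] Q
      by (intro image_closure_subset) (auto simp: linear_conv_bounded_linear closure_subset intro: subsetD)
    moreover have "closure (Q ` \<Omega>) \<subseteq> closure \<omega>"
      using sub by (intro closure_mono) (auto simp: QC)
    ultimately show ?thesis using that by blast
  qed
  obtain s where s: "s \<in> S" "Q s \<noteq> 0"
  proof (rule ccontr)
    assume "\<not> thesis"
    with that have Q0: "\<And>s. s \<in> S \<Longrightarrow> Q s = 0" by blast
    \<comment> \<open>The kernel of \<open>Q\<close> is the orthogonal complement of
      \<open>?V\<close>, which is too small to contain \<open>S\<close>.\<close>
    let ?V = "(*v) A ` coord_space i"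
    have V: "subspace ?V"
      by (intro linear_subspace_image matrix_vector_mul_linear subspace_coord_space)
    have "dim ?V = i"
      by (simp add: dim_image_norm_preserving[OF matrix_vector_mul_linear orthogonal_matrix_norm[OF A]]
          dim_coord_space[OF i(1)])
    moreover have "S \<subseteq> {x \<in> UNIV. \<forall>v\<in>?V. orthogonal v x}"
    proof clarsimp
      fix x c :: "real^'n" assume "x \<in> S" "c \<in> coord_space i"
      then have "c \<bullet> (transpose A *v x) = 0"
        using Q0[of x] inner_coord_proj[of c i "transpose A *v x"] by (simp add: Q_def)
      then show "orthogonal (A *v c) x"
        by (simp add: orthogonal_def dot_lmul_matrix flip: vector_transpose_matrix)
    qed
    then have "dim S \<le> dim {x \<in> UNIV. \<forall>v\<in>?V. orthogonal v x}"
      by (rule dim_subset)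
    ultimately show False
      using dim_subspace_orthogonal_to_vectors[OF V subspace_UNIV subset_UNIV] S(2) i by simp
  qed
  have strict: "(1 - t) *\<^sub>R u + t *\<^sub>R w \<in> \<omega>"
    if "u \<in> closure \<omega>" "w \<in> closure \<omega>" "u \<noteq> w" "0 < t" "t < 1" for u w and t :: real
    using \<omega> that unfolding strictly_convex_domain_in_def by blast
  have "s \<noteq> 0" using s(2) linear_0[OF Q] by auto
  \<comment> \<open>Rescaled to norm \<open>\<rho> / 2\<close>, so that both \<open>y + v\<close>
    and \<open>y - v\<close> belong to the disc.\<close>
  define v where "v = (\<rho> / (2 * norm s)) *\<^sub>R s"
  have v: "v \<in> S" "norm v < \<rho>" "Q v \<noteq> 0"
    using s S(1) \<rho> \<open>s \<noteq> 0\<close> by (auto simp: v_def subspace_scale linear_scale[OF Q])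
  then have "Q (y - v) \<in> closure \<omega>" "Q (y + v) \<in> closure \<omega>"
    using flat[of v] flat[of "- v"] S(1) by (auto intro!: closQ simp: subspace_neg)
  moreover have "Q (y - v) \<noteq> Q (y + v)"
  proof
    assume "Q (y - v) = Q (y + v)"
    then have "2 *\<^sub>R Q v = 0"
      by (simp add: linear_add[OF Q] linear_diff[OF Q] scaleR_2 diff_eq_eq add.assoc)
    then show False using v(3) by simp
  qed
  ultimately have "(1 - 1 / 2) *\<^sub>R Q (y - v) + (1 / 2 :: real) *\<^sub>R Q (y + v) \<in> \<omega>"
    by (rule strict) simp_all
  also have "(1 - 1 / 2) *\<^sub>R Q (y - v) + (1 / 2 :: real) *\<^sub>R Q (y + v) = Q y"
    by (simp add: linear_add[OF Q] linear_diff[OF Q] algebra_simps flip: scaleR_add_left)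
  finally have "y \<in> Q -` \<omega>" by simp
  then show False
    using yC openC by (simp add: QC frontier_def interior_open)
qed

text \<open>Collapsing the face \<open>F\<close> at \<open>y\<close> to a single point makes
  \<open>Q y\<close> exposed in \<open>Q\<close> applied to the closure of \<open>\<Omega>\<close>.
  The dimension bound on the face leaves enough room for a target of dimension
  \<open>CARD('n) - j + 1\<close>.\<close>

lemma no_boundary_flat_imp_class_C:
  fixes \<Omega> :: "(real^'n) set"
  assumes \<Omega>: "bounded_convex_domain \<Omega>" and j: "1 \<le> j" "j \<le> CARD('n)"
    and no_flat: "\<not> boundary_flat j \<Omega>"
  shows "\<Omega> \<in> class_C (CARD('n) - j + 1)"
proof -
  define i where "i = CARD('n) - j + 1"
  have i: "i \<le> CARD('n)" "i = Suc (CARD('n) - j)" using j by (auto simp: i_def)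
  have \<Omega>': "\<Omega> \<noteq> {}" "open \<Omega>" "bounded \<Omega>" "convex \<Omega>"
    using \<Omega> by (auto simp: bounded_convex_domain_def domain_def)
  have "\<exists>A :: real^'n^'n. \<exists>C\<in>cylinders i. orthogonal_matrix A \<and> \<Omega> \<subseteq> (*v) A ` C
      \<and> y \<in> frontier ((*v) A ` C)" if y: "y \<in> frontier \<Omega>" for y
  proof -
    have y': "y \<in> closure \<Omega>" "y \<notin> \<Omega>"
      using y \<Omega>' by (auto simp: frontier_def interior_open)
    then obtain a where a: "a \<noteq> 0" "\<And>x. x \<in> closure \<Omega> \<Longrightarrow> a \<bullet> y \<le> a \<bullet> x"
      "\<And>x. x \<in> rel_interior \<Omega> \<Longrightarrow> a \<bullet> y < a \<bullet> x"
      using supporting_hyperplane_relative_frontier[OF \<Omega>'(4) y'(1)] \<Omega>'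
      by (metis rel_interior_open)
    have a_pos: "0 < a \<bullet> (x - y)" if "x \<in> \<Omega>" for x
      using a(3)[of x] that \<Omega>' by (simp add: rel_interior_open inner_diff_right)
    define F where "F = closure \<Omega> \<inter> {x. a \<bullet> x = a \<bullet> y}"
    have "convex F" unfolding F_def
      by (intro convex_Int convex_closure convex_hyperplane \<Omega>')
    have yF: "y \<in> F" using y' by (simp add: F_def)
    \<comment> \<open>\<open>y\<close> may lie on the relative boundary of the face, so discs are
      sought around a relative interior point \<open>y1\<close>.\<close>
    then obtain y1 where "y1 \<in> rel_interior F"
      using rel_interior_eq_empty[OF \<open>convex F\<close>] by blast
    then obtain \<rho> where y1: "y1 \<in> F" "0 < \<rho>" "ball y1 \<rho> \<inter> affine hull F \<subseteq> F"
      by (auto simp: mem_rel_interior_ball)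
    define L where "L = span ((\<lambda>x. - y1 + x) ` F)"
    have aff: "affine hull F = (\<lambda>x. y1 + x) ` L"
      unfolding L_def using y1(1) by (intro affine_hull_span_gen) (simp add: hull_inc)
    have "dim L < j"
    proof (rule ccontr)
      assume "\<not> dim L < j"
      then obtain S where S: "subspace S" "S \<subseteq> span L" "dim S = j"
        using choose_subspace_of_subspace[of j L] not_less by blast
      have "S \<subseteq> L" using S(2) by (simp only: L_def span_span)
      have "y1 \<in> frontier \<Omega>"
      proof -
        have "a \<bullet> (y1 - y) = 0" "y1 \<in> closure \<Omega>"
          using y1(1) by (simp_all add: F_def inner_diff_right)
        then show ?thesis
          using a_pos[of y1] interior_subset[of \<Omega>] by (auto simp: frontier_def)
      qed
      moreover have "y1 + s \<in> closure \<Omega>" if "s \<in> S" "norm s < \<rho>" for s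
      proof -
        have "y1 + s \<in> F"
        proof (rule subsetD[OF y1(3)], intro IntI)
          show "y1 + s \<in> ball y1 \<rho>" using that by (simp add: dist_norm)
          show "y1 + s \<in> affine hull F" using that \<open>S \<subseteq> L\<close> unfolding aff by blast
        qed
        then show ?thesis by (simp add: F_def)
      qed
      ultimately have "boundary_flat j \<Omega>"
        unfolding boundary_flat_def using S(1,3) y1(2) by blast
      with no_flat show False ..
    qed
    have perp_a: "a \<bullet> l = 0" if "l \<in> L" for l
      using that unfolding L_def
      by (rule span_induct) (use y1(1) in \<open>auto simp: subspace_def inner_simps F_def\<close>)
    let ?L' = "{x \<in> UNIV. \<forall>l\<in>L. orthogonal l x}"
    \<comment> \<open>The complement of \<open>L\<close> and \<open>a\<close> together has dimension
      \<open>CARD('n) - dim L - 1\<close>, at least \<open>CARD('n) - j\<close> because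
      \<open>dim L < j\<close>. Adding \<open>a\<close> to \<open>T\<close> then gives
      \<open>U\<close> dimension \<open>i\<close>; the complement of \<open>U\<close> contains
      \<open>L\<close> and is orthogonal to \<open>a\<close>.\<close>
    let ?L'' = "{x \<in> ?L'. \<forall>l\<in>span {a}. orthogonal l x}"
    have L': "subspace ?L'"
      by (auto simp: subspace_def orthogonal_def inner_add_right)
    have aL': "a \<in> ?L'" using perp_a by (simp add: orthogonal_def inner_commute)
    have "dim ?L' + dim L = CARD('n)"
      using dim_subspace_orthogonal_to_vectors[of L UNIV] by (simp add: L_def)
    moreover have "dim ?L'' + 1 = dim ?L'"
    proof -
      have "span {a} \<subseteq> ?L'" using aL' by (intro span_minimal L') blast
      from dim_subspace_orthogonal_to_vectors[OF subspace_span L' this]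
      show ?thesis using a(1) by (simp only: dim_span dim_singleton if_False)
    qed
    ultimately have "CARD('n) - j \<le> dim ?L''"
      using \<open>dim L < j\<close> by simp
    then obtain T where T: "subspace T" "T \<subseteq> span ?L''" "dim T = CARD('n) - j"
      using choose_subspace_of_subspace by blast
    have "subspace ?L''"
      by (auto simp: subspace_def orthogonal_def inner_add_right)
    from span_minimal[OF subset_refl this] T(2) have TL: "T \<subseteq> ?L''"
      by (rule order_trans[rotated])
    define U where "U = span (insert a T)"
    have "a \<notin> T"
    proof
      assume "a \<in> T"
      then have "orthogonal a a"
        using TL span_base[of a "{a}"] by blast
      then show False using a(1) by (simp add: orthogonal_self)
    qed
    then have "a \<notin> span T" using T(1) by (metis span_eq_iff)
    then have "dim U = i"
      unfolding U_def dim_span dim_insert using T(3) i(2) by simp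
    moreover have "subspace U" by (simp add: U_def)
    ultimately obtain A :: "real^'n^'n"
      where A: "orthogonal_matrix A" "(*v) A ` coord_space i = U"
      using orthogonal_matrix_onto_subspace i(1) by blast
    define Q where "Q x = coord_proj i (transpose A *v x)" for x
    have Q: "linear Q" and QC: "(*v) A ` (coord_proj i -` \<omega>) = Q -` \<omega>" for \<omega>
      using orthogonal_cylinder[OF A(1)] by (simp_all add: Q_def[abs_def])
    have Qin: "Q x \<in> coord_space i" for x
      by (simp add: Q_def coord_proj_in_coord_space)
    \<comment> \<open>\<open>Q\<close> reads off the coordinates of the orthogonal projection onto
      \<open>U\<close>, and \<open>U\<close> is orthogonal to \<open>L\<close>.\<close>
    have QL: "Q l = 0" if "l \<in> L" for l
    proof -
      have "insert a T \<subseteq> {x. l \<bullet> x = 0}"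
        using that TL perp_a[OF that] inner_commute[of a l] by (auto simp: orthogonal_def)
      then have "U \<subseteq> {x. l \<bullet> x = 0}"
        unfolding U_def by (intro span_minimal) (auto simp: subspace_def inner_simps)
      moreover have "A *v Q l \<in> U"
        using Qin unfolding A(2)[symmetric] by (rule imageI)
      ultimately have "l \<bullet> (A *v Q l) = 0"
        by blast
      then have "Q l \<bullet> (transpose A *v l) = 0"
        by (simp add: inner_commute[of "Q l"] dot_lmul_matrix)
      then have "Q l \<bullet> Q l = 0"
        using inner_coord_proj[OF Qin, of l] by (simp add: Q_def)
      then show ?thesis by simp
    qed
    \<comment> \<open>As \<open>a\<close> lies in \<open>U\<close>, the supporting functional
      factors through \<open>Q\<close>; \<open>e\<close> represents it on
      \<open>coord_space i\<close>.\<close>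
    obtain e where e: "e \<in> coord_space i" "a = A *v e"
      using A(2) span_base[of a "insert a T"] by (auto simp: U_def)
    have eQ: "e \<bullet> Q x = a \<bullet> x" for x
      unfolding Q_def inner_coord_proj[OF e(1)] e(2)
      by (simp add: dot_lmul_matrix flip: vector_transpose_matrix)
    have contQ: "continuous_on X Q" for X
      using Q by (simp add: linear_continuous_on linear_conv_bounded_linear)
    \<comment> \<open>Equality would put a preimage \<open>u\<close> of \<open>k\<close> into the
      face, where \<open>u - y\<close> lies in \<open>L\<close> and is killed by
      \<open>Q\<close>.\<close>
    have exposed: "0 < e \<bullet> (k - Q y)" if k: "k \<in> Q ` closure \<Omega>" "k \<noteq> Q y" for k
    proof (rule ccontr)
      obtain u where u: "u \<in> closure \<Omega>" "k = Q u" using k by blast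
      assume "\<not> ?thesis"
      then have "a \<bullet> u = a \<bullet> y"
        using a(2)[OF u(1)] by (simp add: u(2) inner_diff_right eQ)
      then have "u \<in> F" using u by (simp add: F_def)
      then have "(- y1 + u) - (- y1 + y) \<in> L"
        unfolding L_def using yF by (intro span_diff span_base) auto
      then have "Q (u - y) = 0" using QL by simp
      then show False using k(2) u(2) by (simp add: linear_diff[OF Q])
    qed
    have Q_sub: "Q ` \<Omega> \<subseteq> Q ` closure \<Omega> - {Q y}"
      using a_pos closure_subset by (fastforce simp: inner_diff_right simp flip: eQ)
    obtain \<omega> where \<omega>: "bounded \<omega>" "strictly_convex_domain_in (coord_space i) \<omega>"
      "Q ` closure \<Omega> - {Q y} \<subseteq> \<omega>" "Q y \<notin> \<omega>"
    proof (rule strictly_convex_domain_at_exposed_point[OF subspace_coord_space])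
      show "Q ` closure \<Omega> \<subseteq> coord_space i" "Q y \<in> coord_space i"
        using Qin by auto
      show "compact (Q ` closure \<Omega>)"
        using \<Omega>' by (intro compact_continuous_image contQ) simp
      show "Q ` closure \<Omega> - {Q y} \<noteq> {}"
        using Q_sub \<Omega>' by blast
    qed (use exposed in auto)
    have "\<Omega> \<subseteq> Q -` \<omega>" using Q_sub \<omega>(3) by blast
    moreover have "y \<in> frontier (Q -` \<omega>)"
    proof -
      have "y \<in> closure (Q -` \<omega>)"
        using closure_mono[OF \<open>\<Omega> \<subseteq> Q -` \<omega>\<close>] y' by blast
      then show ?thesis
        using \<omega>(4) interior_subset by (auto simp: frontier_def)
    qed
    moreover have "coord_proj i -` \<omega> \<in> cylinders i"
      using \<omega> by (auto simp: cylinders_def)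
    ultimately show ?thesis using A(1) QC by metis
  qed
  with \<Omega> show ?thesis by (simp add: class_C_def i_def)
qed

theorem proposition29:
  fixes \<Omega> :: "(real^'n) set" and j :: nat
  assumes "j \<in> {1..CARD('n)}"
    and "\<Omega> \<noteq> {}" and "bounded \<Omega>" and "open \<Omega>" and "convex \<Omega>"
  shows "\<Omega> \<in> class_G j \<longleftrightarrow> \<Omega> \<in> class_C (CARD('n) - j + 1)"
proof -
  have "bounded_convex_domain \<Omega>"
    using assms by (simp add: bounded_convex_domain_def domain_def convex_connected)
  then have "\<Omega> \<in> class_G j \<longleftrightarrow> \<not> boundary_flat j \<Omega>"
    using class_G_imp_no_boundary_flat no_boundary_flat_imp_class_G assms(1) by auto
  moreover have "\<Omega> \<in> class_C (CARD('n) - j + 1) \<longleftrightarrow> \<not> boundary_flat j \<Omega>"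
  proof
    assume "\<Omega> \<in> class_C (CARD('n) - j + 1)"
    then show "\<not> boundary_flat j \<Omega>"
      by (rule class_C_imp_no_boundary_flat) (use assms(1) in auto)
  next
    assume "\<not> boundary_flat j \<Omega>"
    then show "\<Omega> \<in> class_C (CARD('n) - j + 1)"
      using \<open>bounded_convex_domain \<Omega>\<close> assms(1) by (intro no_boundary_flat_imp_class_C) auto
  qed
  ultimately show ?thesis by simp
qed

end
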